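(* Let $\mathcal{F}$ be a family of subgraphs of $K_8$ (on a fixed vertex set of size $8$) such that for any two graphs $G_1, G_2 \in \mathcal{F}$, the agreement $G_1 \triangle' G_2 := (G_1 \cap G_2) \cup (\overline{G_1} \cap \overline{G_2})$ is not bipartite. Then $|\mathcal{F}| \leq 2^{\binom{8}{2}-3} = 2^{25}$, with equality if and only if $\mathcal{F}$ is a triangulumvirate.
   Context: Graphs are identified with their edge sets, all on the same fixed set of $8$ vertices; $\overline{G}$ denotes the complement of $G$ with respect to $K_8$. A family as in the hypothesis is called non-bipartite-agreeing (applied also with $G_1=G_2$ allowed or not makes no difference for the agreement of a graph with itself is $K_8$). A triangulumvirate is a family of the form $\{G \subseteq K_8 : G \cap T = T_0\}$, where $T$ is a triangle (a copy of $K_3$ in $K_8$) and $T_0 \subseteq T$ is a fixed set of edges. *)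

theory Defs
  imports "HOL-Library.Ramsey"
begin

(* A simple graph on the vertex set V is identified with its edge set, a set of 2-element
   subsets of V; [V]\<^bsup>2\<^esup> is the library notation for the set of all 2-element subsets. *)

abbreviation complete_graph :: "'a set \<Rightarrow> 'a set set" where
  "complete_graph V \<equiv> [V]\<^bsup>2\<^esup>"

definition graph_complement :: "'a set \<Rightarrow> 'a set set \<Rightarrow> 'a set set" where
  "graph_complement V G = complete_graph V - G"

definition agreement :: "'a set \<Rightarrow> 'a set set \<Rightarrow> 'a set set \<Rightarrow> 'a set set" where
  "agreement V G1 G2 = (G1 \<inter> G2) \<union> (graph_complement V G1 \<inter> graph_complement V G2)"

(* The parts X and Y may be empty. *)
definition bipartite :: "'a set \<Rightarrow> 'a set set \<Rightarrow> bool" where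
  "bipartite V G \<longleftrightarrow>
     (\<exists>X Y. X \<union> Y = V \<and> X \<inter> Y = {} \<and> (\<forall>e\<in>G. \<exists>x\<in>X. \<exists>y\<in>Y. e = {x, y}))"

definition non_bipartite_agreeing :: "'a set \<Rightarrow> 'a set set set \<Rightarrow> bool" where
  "non_bipartite_agreeing V F \<longleftrightarrow> (\<forall>G1\<in>F. \<forall>G2\<in>F. \<not> bipartite V (agreement V G1 G2))"

definition is_triangle :: "'a set \<Rightarrow> 'a set set \<Rightarrow> bool" where
  "is_triangle V T \<longleftrightarrow> (\<exists>S\<subseteq>V. card S = 3 \<and> T = complete_graph S)"

definition triangulumvirate :: "'a set \<Rightarrow> 'a set set set \<Rightarrow> bool" where
  "triangulumvirate V F \<longleftrightarrow>
     (\<exists>T T0. is_triangle V T \<and> T0 \<subseteq> T \<and> F = {G. G \<subseteq> complete_graph V \<and> G \<inter> T = T0})"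

end

theory Submission
  imports Complex_Main Defs
begin

text \<open>
  Let \<open>hat F S\<close> be the Fourier coefficients of the indicator function of \<open>F\<close>. If \<open>C\<close> is the edge
  set of a cut, no agreement lies inside \<open>C\<close>; expanding the square, this says that for every \<open>J \<subseteq> C\<close>
  the sum of \<open>(-1)^|S| (hat F S)^2\<close> over all \<open>S\<close> with \<open>S \<inter> C = J\<close> vanishes. Take the combination with
  weight 2 for \<open>J = {}\<close> and weight -1 for \<open>|J| = 1\<close>, summed over the 70 sets \<open>A\<close> of four vertices.
  The coefficient of \<open>(hat F S)^2\<close> becomes \<open>(-1)^|S| (2 n0 - n1)\<close>, where \<open>nk\<close> counts the \<open>A\<close> whose cut
  meets \<open>S\<close> in \<open>k\<close> edges. It is 140 for \<open>S = {}\<close>, and at least -20 otherwise, so Hoffman's argument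
  and Parseval's identity give the bound.

  In case of equality all \<open>S\<close> with coefficient above -20 have \<open>hat F S = 0\<close>, so the indicator function
  has degree at most 3 and no mixed differences in two disjoint edges. A nonzero function of
  degree \<open>d\<close> on the cube is nonzero on at least a fraction \<open>2^-d\<close> of it; applied to the derivative in
  an edge \<open>e\<close> on which membership in \<open>F\<close> depends, this shows that changing \<open>e\<close> always leaves \<open>F\<close>. Hence the
  relevant edges pairwise intersect. They do not form a star, as that would be a bipartite
  agreement, so they form a triangle.
\<close>

section \<open>Fourier coefficients of a family of sets\<close>

text \<open>The Walsh character \<open>(-1)^|S Int G|\<close> of the cube of all sets
  \<open>G\<close>, for finite \<open>S\<close>.\<close>

definition character :: "'b set \<Rightarrow> 'b set \<Rightarrow> real" where
  "character S G = (\<Prod>x\<in>S. if x \<in> G then - 1 else 1)"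

text \<open>Not divided by the size of the cube, so \<open>hat F {}\<close> is the cardinality of
  \<open>F\<close>, and Parseval's identity and the inversion formula carry a factor
  \<open>2 ^ card E\<close>.\<close>

definition hat :: "'b set set \<Rightarrow> 'b set \<Rightarrow> real" where
  "hat F S = (\<Sum>G\<in>F. character S G)"

lemma hat_square: "(hat F S)\<^sup>2 = (\<Sum>G\<in>F. \<Sum>G'\<in>F. character S G * character S G')"
  by (simp add: power2_eq_square hat_def sum_product)

lemma character_empty [simp]: "character {} G = 1"
  by (simp add: character_def)

lemma hat_empty [simp]: "hat F {} = real (card F)"
  by (simp add: hat_def)

lemma character_Un:
  assumes "finite A" "finite B" "A \<inter> B = {}"
  shows "character (A \<union> B) G = character A G * character B G"
  unfolding character_def using assms by (rule prod.union_disjoint)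

text \<open>The sum factors over the elements of \<open>E\<close> into factors \<open>1 + 1\<close>
  or \<open>-1 + 1\<close>, so one common element of \<open>E\<close> and \<open>G\<close> makes it
  vanish.\<close>

lemma sum_character:
  assumes "finite E"
  shows "(\<Sum>S\<in>Pow E. character S G) = (if E \<inter> G = {} then 2 ^ card E else 0)"
proof -
  have "(\<Sum>S\<in>Pow E. character S G) = (\<Prod>x\<in>E. (if x \<in> G then - 1 else 1) + 1)"
    unfolding character_def by (simp add: prod_add[OF assms])
  also have "\<dots> = (if E \<inter> G = {} then 2 ^ card E else 0)"
  proof (cases "E \<inter> G = {}")
    case True
    then have "(\<Prod>x\<in>E. (if x \<in> G then - 1 else 1) + 1) = (\<Prod>x\<in>E. (2::real))"
      by (intro prod.cong) auto
    with True show ?thesis by simp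
  next
    case False
    then show ?thesis using assms by (auto intro!: prod_zero)
  qed
  finally show ?thesis .
qed

lemma character_mult:
  assumes "finite S"
  shows "character S G * character S G' = character S (sym_diff G G')"
  unfolding character_def prod.distrib[symmetric] by (intro prod.cong) auto

text \<open>Within \<open>complete_graph V\<close> the agreement is the complement of the symmetric
  difference, so each of the \<open>card S\<close> factors changes sign. This is the source of the
  signs in the relations below.\<close>

lemma character_agreement:
  assumes "finite S" "S \<subseteq> complete_graph V"
  shows "(-1) ^ card S * (character S G * character S G') = character S (agreement V G G')"
proof -
  have "(-1) ^ card S * (character S G * character S G')
      = (\<Prod>x\<in>S. - ((if x \<in> G then - 1 else 1) * (if x \<in> G' then - 1 else 1)))"
    unfolding character_def prod.distrib[symmetric] prod_uminus ..
  also have "\<dots> = character S (agreement V G G')"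
    unfolding character_def agreement_def graph_complement_def
    using assms by (intro prod.cong) auto
  finally show ?thesis .
qed

lemma sum_Pow_split:
  assumes "C \<subseteq> E"
  shows "(\<Sum>S\<in>Pow E. h S) = (\<Sum>J\<in>Pow C. \<Sum>R\<in>Pow (E - C). h (J \<union> R))"
proof -
  have "(\<Sum>J\<in>Pow C. \<Sum>R\<in>Pow (E - C). h (J \<union> R))
      = (\<Sum>(J, R)\<in>Pow C \<times> Pow (E - C). h (J \<union> R))"
    by (simp add: sum.cartesian_product)
  also have "\<dots> = (\<Sum>S\<in>Pow E. h S)"
    using assms
    by (intro sum.reindex_bij_witness[where i = "\<lambda>S. (S \<inter> C, S - C)" and j = "\<lambda>(J, R). J \<union> R"]) auto
  finally show ?thesis by simp
qed

lemma sum_rotate3: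
  "(\<Sum>a\<in>A. \<Sum>b\<in>B. \<Sum>c\<in>C. h a b c) = (\<Sum>b\<in>B. \<Sum>c\<in>C. \<Sum>a\<in>A. h a b c)"
  by (rule trans[OF sum.swap sum.cong[OF refl sum.swap]])

text \<open>After expanding the square, split \<open>S\<close> into \<open>J = S Int C\<close> and
  \<open>R = S - C\<close>. The sum over \<open>R\<close> is that of \<open>sum_character\<close>,
  and it vanishes because the agreement has an edge outside \<open>C\<close>. The weight
  \<open>\<phi>\<close> can be arbitrary because it depends on \<open>J\<close> only.\<close>

lemma cut_relation:
  assumes fin: "finite V" and F: "F \<subseteq> Pow (complete_graph V)" and C: "C \<subseteq> complete_graph V"
    and agr: "\<And>G G'. G \<in> F \<Longrightarrow> G' \<in> F \<Longrightarrow> \<not> agreement V G G' \<subseteq> C"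
  shows "(\<Sum>S\<in>Pow (complete_graph V). \<phi> (S \<inter> C) * (-1) ^ card S * (hat F S)\<^sup>2) = 0"
proof -
  let ?E = "complete_graph V"
  have finE: "finite ?E" using fin by (simp add: finite_imp_finite_nsets)
  have finS: "finite S" if "S \<in> Pow ?E" for S using that finE finite_subset by auto
  have "(\<Sum>S\<in>Pow ?E. \<phi> (S \<inter> C) * (-1) ^ card S * (hat F S)\<^sup>2)
      = (\<Sum>S\<in>Pow ?E. \<Sum>G\<in>F. \<Sum>G'\<in>F. \<phi> (S \<inter> C) * character S (agreement V G G'))"
  proof (intro sum.cong refl)
    fix S assume S: "S \<in> Pow ?E"
    have "\<phi> (S \<inter> C) * (-1) ^ card S * (hat F S)\<^sup>2
        = (\<Sum>G\<in>F. \<Sum>G'\<in>F. \<phi> (S \<inter> C) * ((-1) ^ card S * (character S G * character S G')))"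
      by (simp only: hat_square sum_distrib_left mult.assoc)
    also have "\<dots> = (\<Sum>G\<in>F. \<Sum>G'\<in>F. \<phi> (S \<inter> C) * character S (agreement V G G'))"
      using character_agreement[OF finS[OF S]] S by simp
    finally show "\<phi> (S \<inter> C) * (-1) ^ card S * (hat F S)\<^sup>2 = \<dots>" .
  qed
  also have "\<dots> = (\<Sum>G\<in>F. \<Sum>G'\<in>F. \<Sum>S\<in>Pow ?E. \<phi> (S \<inter> C) * character S (agreement V G G'))"
    by (rule sum_rotate3)
  also have "\<dots> = (\<Sum>G\<in>F. \<Sum>G'\<in>F. 0)"
  proof (intro sum.cong refl)
    fix G G' assume GG: "G \<in> F" "G' \<in> F"
    let ?X = "agreement V G G'"
    have "?X \<subseteq> ?E" using F GG unfolding agreement_def graph_complement_def by blast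
    then have nz: "(?E - C) \<inter> ?X \<noteq> {}" using agr[OF GG] by blast
    have "(\<Sum>S\<in>Pow ?E. \<phi> (S \<inter> C) * character S ?X)
        = (\<Sum>J\<in>Pow C. \<Sum>R\<in>Pow (?E - C). \<phi> ((J \<union> R) \<inter> C) * character (J \<union> R) ?X)"
      by (rule sum_Pow_split[OF C])
    also have "\<dots> = (\<Sum>J\<in>Pow C. \<Sum>R\<in>Pow (?E - C). \<phi> J * character J ?X * character R ?X)"
    proof (intro sum.cong refl)
      fix J R assume JR: "J \<in> Pow C" "R \<in> Pow (?E - C)"
      then have "(J \<union> R) \<inter> C = J" "J \<inter> R = {}" "finite J" "finite R"
        using C finE by (auto intro: finite_subset)
      then show "\<phi> ((J \<union> R) \<inter> C) * character (J \<union> R) ?X = \<phi> J * character J ?X * character R ?X"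
        by (simp add: character_Un)
    qed
    also have "\<dots> = (\<Sum>J\<in>Pow C. \<phi> J * character J ?X * (\<Sum>R\<in>Pow (?E - C). character R ?X))"
      by (simp add: sum_distrib_left)
    also have "\<dots> = 0"
      using finE nz by (simp add: sum_character)
    finally show "(\<Sum>S\<in>Pow ?E. \<phi> (S \<inter> C) * character S ?X) = 0" .
  qed
  finally show ?thesis by simp
qed

text \<open>Parseval's identity: by orthogonality only the pairs with \<open>G' = G\<close>
  survive.\<close>

lemma sum_hat_square:
  assumes fin: "finite E" and F: "F \<subseteq> Pow E"
  shows "(\<Sum>S\<in>Pow E. (hat F S)\<^sup>2) = 2 ^ card E * real (card F)"
proof -
  have finF: "finite F" using F fin by (simp add: finite_subset)
  have finS: "finite S" if "S \<in> Pow E" for S using that fin finite_subset by auto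
  have "(\<Sum>S\<in>Pow E. (hat F S)\<^sup>2) = (\<Sum>S\<in>Pow E. \<Sum>G\<in>F. \<Sum>G'\<in>F. character S (sym_diff G G'))"
    by (intro sum.cong refl) (simp add: hat_square character_mult[OF finS])
  also have "\<dots> = (\<Sum>G\<in>F. \<Sum>G'\<in>F. \<Sum>S\<in>Pow E. character S (sym_diff G G'))"
    by (rule sum_rotate3)
  also have "\<dots> = (\<Sum>G\<in>F. \<Sum>G'\<in>F. if G' = G then 2 ^ card E else 0)"
  proof (intro sum.cong refl)
    fix G G' assume "G \<in> F" "G' \<in> F"
    then have "E \<inter> sym_diff G G' = {} \<longleftrightarrow> G' = G" using F by blast
    then show "(\<Sum>S\<in>Pow E. character S (sym_diff G G')) = (if G' = G then 2 ^ card E else 0)"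
      by (simp only: sum_character[OF fin])
  qed
  also have "\<dots> = 2 ^ card E * real (card F)"
    using finF by simp
  finally show ?thesis .
qed

text \<open>Fourier inversion for the indicator function of \<open>F\<close>, again by
  orthogonality.\<close>

lemma hat_inversion:
  assumes fin: "finite E" and F: "F \<subseteq> Pow E" and G: "G \<subseteq> E"
  shows "(\<Sum>S\<in>Pow E. hat F S * character S G) = 2 ^ card E * (if G \<in> F then 1 else 0)"
proof -
  have finF: "finite F" using F fin by (simp add: finite_subset)
  have finS: "finite S" if "S \<in> Pow E" for S using that fin finite_subset by auto
  have "(\<Sum>S\<in>Pow E. hat F S * character S G) = (\<Sum>S\<in>Pow E. \<Sum>G'\<in>F. character S (sym_diff G' G))"
    by (intro sum.cong refl) (simp add: hat_def sum_distrib_right character_mult[OF finS])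
  also have "\<dots> = (\<Sum>G'\<in>F. \<Sum>S\<in>Pow E. character S (sym_diff G' G))"
    by (rule sum.swap)
  also have "\<dots> = (\<Sum>G'\<in>F. if G' = G then 2 ^ card E else 0)"
  proof (intro sum.cong refl)
    fix G' assume "G' \<in> F"
    then have "E \<inter> sym_diff G' G = {} \<longleftrightarrow> G' = G" using F G by blast
    then show "(\<Sum>S\<in>Pow E. character S (sym_diff G' G)) = (if G' = G then 2 ^ card E else 0)"
      by (simp only: sum_character[OF fin])
  qed
  also have "\<dots> = 2 ^ card E * (if G \<in> F then 1 else 0)"
    using finF by simp
  finally show ?thesis .
qed

section \<open>Counting the balanced cuts with few crossing edges\<close>

definition cut_edges :: "'a set \<Rightarrow> 'a set \<Rightarrow> 'a set set" where
  "cut_edges V A = {e \<in> complete_graph V. card (e \<inter> A) = 1}"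

lemma doubleton_in_cut_edges:
  assumes "x \<noteq> y"
  shows "{x, y} \<in> cut_edges V A \<longleftrightarrow> x \<in> V \<and> y \<in> V \<and> (x \<in> A) \<noteq> (y \<in> A)"
proof -
  have "{x, y} \<inter> A = (if x \<in> A then {x} else {}) \<union> (if y \<in> A then {y} else {})" by auto
  then show ?thesis using assms by (auto simp: cut_edges_def)
qed

section \<open>Tables computed on the vertices 0, ..., 7\<close>

definition halves :: "nat list list" where
  "halves = filter (\<lambda>l. length l = 4) (subseqs [0..<8])"

text \<open>The 28 edges of the numbered complete graph. Putting the smaller vertex first represents
  every edge exactly once.\<close>

definition slots :: "(nat \<times> nat) list" where
  "slots = concat (map (\<lambda>j. map (\<lambda>i. (i, j)) [0..<j]) [0..<8])"

definition crosses :: "nat \<times> nat \<Rightarrow> nat list \<Rightarrow> bool" where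
  "crosses = (\<lambda>(i, j) l. (i \<in> set l) \<noteq> (j \<in> set l))"

definition row :: "nat \<times> nat \<Rightarrow> bool list" where
  "row p = map (crosses p) halves"

definition at_most_one :: "bool \<Rightarrow> bool \<Rightarrow> bool \<Rightarrow> bool \<Rightarrow> bool" where
  "at_most_one a b c d \<longleftrightarrow>
     (if a then \<not> b \<and> \<not> c \<and> \<not> d else if b then \<not> c \<and> \<not> d else \<not> c \<or> \<not> d)"

definition few_crossings :: "bool list \<Rightarrow> bool list \<Rightarrow> bool list \<Rightarrow> bool list \<Rightarrow> nat" where
  "few_crossings r1 r2 r3 r4 =
     length (filter (\<lambda>(a, b, c, d). at_most_one a b c d) (zip r1 (zip r2 (zip r3 r4))))"

text \<open>Two edges of a graph can be numbered as (0,1), (2,3) or as (0,1), (0,2), so that only the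
  remaining edges have to be enumerated.\<close>

lemma few_crossings_matching:
  "sorted_wrt (\<lambda>r r'. few_crossings (row (0,1)) (row (2,3)) r r' \<le> 18)
     (map row (filter (\<lambda>p. p \<notin> {(0,1), (2,3)}) slots))"
  by code_simp

lemma few_crossings_cherry:
  "sorted_wrt (\<lambda>r r'. few_crossings (row (0,1)) (row (0,2)) r r' \<le> 18)
     (map row (filter (\<lambda>p. p \<notin> {(0,1), (0,2)}) slots))"
  by code_simp


text \<open>Bounds \<open>n0\<close> for graphs that have two disjoint edges and at least one
  further edge.\<close>

lemma two_free_matching:
  "\<forall>p\<in>set slots. p \<notin> {(0,1), (2,3)} \<longrightarrow>
     length (filter (\<lambda>l. \<not> crosses (0,1) l \<and> \<not> crosses (2,3) l \<and> \<not> crosses p l) halves) \<le> 6"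
  by code_simp

text \<open>The slot \<open>(1,2)\<close> has to be excluded because it closes a triangle: a half
  that separates neither \<open>(0,1)\<close> nor \<open>(0,2)\<close> never separates
  \<open>(1,2)\<close>, and there are 10 such halves.\<close>

lemma two_free_cherry:
  "\<forall>p\<in>set slots. p \<notin> {(0,1), (0,2), (1,2)} \<longrightarrow>
     length (filter (\<lambda>l. \<not> crosses (0,1) l \<and> \<not> crosses (0,2) l \<and> \<not> crosses p l) halves) \<le> 6"
  by code_simp

text \<open>Both ends inside or both outside gives \<open>15 + 15\<close> of the 70 halves. The
  coefficient of a single edge is therefore \<open>-(2 * 30 - 40) = -20\<close>, the extreme
  value.\<close>

lemma counts_edge:
  "length (filter (\<lambda>l. \<not> crosses (0,1) l) halves) = 30"
  "length (filter (\<lambda>l. crosses (0,1) l) halves) = 40"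
  by code_simp+

text \<open>The extreme value again: \<open>2 * 10 - 40 = -20\<close>.\<close>

lemma counts_cherry:
  "length (filter (\<lambda>l. \<not> crosses (0,1) l \<and> \<not> crosses (0,2) l) halves) = 10"
  "length (filter (\<lambda>l. crosses (0,1) l \<noteq> crosses (0,2) l) halves) = 40"
  by code_simp+

text \<open>Two disjoint edges stay above the extreme value:
  \<open>2 * 14 - 32 = -4\<close>.\<close>

lemma counts_matching:
  "length (filter (\<lambda>l. \<not> crosses (0,1) l \<and> \<not> crosses (2,3) l) halves) = 14"
  "length (filter (\<lambda>l. crosses (0,1) l \<noteq> crosses (2,3) l) halves) = 32"
  by code_simp+

(* The simplifier would otherwise expand [0..<8] and then all 256 entries of its subseqs. *)
declare upt_rec_numeral [simp del]

lemma set_slots: "set slots = {(i, j). i < j \<and> j < 8}"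
  by (auto simp: slots_def)

section \<open>Transfer from numbered vertices to \<open>V\<close>\<close>

definition edge :: "(nat \<Rightarrow> 'a) \<Rightarrow> nat \<times> nat \<Rightarrow> 'a set" where
  "edge f p = {f (fst p), f (snd p)}"

lemma inj_on_edge:
  assumes "inj_on f {..<8}"
  shows "inj_on (edge f) (set slots)"
proof (rule inj_onI)
  fix p q assume p: "p \<in> set slots" and q: "q \<in> set slots" and eq: "edge f p = edge f q"
  obtain i j where [simp]: "p = (i, j)" by fastforce
  obtain k l where [simp]: "q = (k, l)" by fastforce
  have "f i = f k \<and> f j = f l \<or> f i = f l \<and> f j = f k"
    using eq by (simp add: edge_def doubleton_eq_iff)
  moreover have "i < 8" "j < 8" "k < 8" "l < 8" using p q by (auto simp: set_slots)
  ultimately have "i = k \<and> j = l \<or> i = l \<and> j = k"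
    using assms by (simp add: inj_on_eq_iff)
  then show "p = q" using p q by (auto simp: set_slots)
qed

lemma edge_in_slots:
  assumes "bij_betw f {..<8} V" "e \<in> complete_graph V"
  obtains p where "p \<in> set slots" "e = edge f p"
proof -
  obtain x y where xy: "e = {x, y}" "x \<in> V" "y \<in> V" "x \<noteq> y"
    using assms(2) by (rule nsets2_E)
  then obtain i j where "i < 8" "j < 8" "x = f i" "y = f j"
    using assms(1) unfolding bij_betw_def by (metis imageE lessThan_iff)
  with xy have "i \<noteq> j" by auto
  then consider "i < j" | "j < i" by linarith
  then show thesis
  proof cases
    case 1
    then show thesis
      using that[of "(i, j)"] xy \<open>j < 8\<close> \<open>x = f i\<close> \<open>y = f j\<close> by (simp add: set_slots edge_def)
  next
    case 2
    then show thesis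
      using that[of "(j, i)"] xy \<open>i < 8\<close> \<open>x = f i\<close> \<open>y = f j\<close>
      by (simp add: set_slots edge_def insert_commute)
  qed
qed

lemma set_halves: "l \<in> set halves \<longleftrightarrow> l \<in> set (subseqs [0..<8]) \<and> length l = 4"
  by (auto simp: halves_def)

lemma halves_subset: "l \<in> set halves \<Longrightarrow> set l \<subseteq> {..<8}"
  using subseqs_powset[of "[0..<8]"] by (simp add: set_halves lessThan_atLeast0) blast

lemma crosses_iff:
  assumes "bij_betw f {..<8} V" "p \<in> set slots" "l \<in> set halves"
  shows "edge f p \<in> cut_edges V (f ` set l) \<longleftrightarrow> crosses p l"
proof -
  obtain i j where p: "p = (i, j)" "i < j" "j < 8" using assms(2) by (auto simp: set_slots)
  have inj: "inj_on f {..<8}" and im: "f ` {..<8} = V" using assms(1) by (auto simp: bij_betw_def)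
  have mem: "f k \<in> f ` set l \<longleftrightarrow> k \<in> set l" if "k < 8" for k
    using inj_on_image_mem_iff[OF inj _ halves_subset[OF assms(3)], of k] that by simp
  have "f i \<noteq> f j" using inj p by (auto dest: inj_onD)
  then show ?thesis using p mem im by (auto simp: edge_def doubleton_in_cut_edges crosses_def)
qed

text \<open>Every set of four vertices is the image under \<open>f\<close> of exactly one list in
  \<open>halves\<close>, since \<open>subseqs\<close> lists each subset once. Counts over
  \<open>V\<close> thereby become lengths that can be evaluated.\<close>

lemma card_halves:
  assumes "bij_betw f {..<8} V"
  shows "card {A \<in> [V]\<^bsup>4\<^esup>. P A} = length (filter (\<lambda>l. P (f ` set l)) halves)"
proof -
  have inj: "inj_on f {..<8}" and im: "f ` {..<8} = V" using assms by (auto simp: bij_betw_def)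
  have d: "distinct (map set (subseqs [0..<8]))" by (simp add: distinct_set_subseqs)
  then have dist: "distinct halves" and inj_set: "inj_on set (set halves)"
    by (auto simp: halves_def distinct_map intro: inj_on_subset)
  have card_set: "card (set l) = 4" if "l \<in> set halves" for l
    using that subseqs_distinctD[of l "[0..<8]"] by (auto simp: set_halves distinct_card)
  have inj': "inj_on (\<lambda>l. f ` set l) (set halves)"
  proof (rule inj_onI)
    fix l l' assume l: "l \<in> set halves" "l' \<in> set halves" "f ` set l = f ` set l'"
    then have "set l = set l'"
      using inj_on_image_eq_iff[OF inj] halves_subset by metis
    with l inj_set show "l = l'" by (auto dest: inj_onD)
  qed
  have "{A \<in> [V]\<^bsup>4\<^esup>. P A} = (\<lambda>l. f ` set l) ` set (filter (\<lambda>l. P (f ` set l)) halves)"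
  proof (intro equalityI subsetI)
    fix A assume A: "A \<in> {A \<in> [V]\<^bsup>4\<^esup>. P A}"
    then have "A \<subseteq> f ` {..<8}" "card A = 4" "P A" using im by (auto simp: nsets_def)
    then obtain B where B: "B \<subseteq> {..<8}" "A = f ` B" by (meson subset_imageE)
    then have "card B = 4" using \<open>card A = 4\<close> inj by (metis card_image inj_on_subset)
    have "B \<in> set ` set (subseqs [0..<8])" using B by (intro subset_subseqs) auto
    then obtain l where l: "l \<in> set (subseqs [0..<8])" "B = set l" by blast
    then have "length l = 4"
      using \<open>card B = 4\<close> subseqs_distinctD[of l "[0..<8]"] by (simp add: distinct_card)
    with l B \<open>P A\<close> show "A \<in> (\<lambda>l. f ` set l) ` set (filter (\<lambda>l. P (f ` set l)) halves)"
      by (auto simp: set_halves)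
  next
    fix A assume "A \<in> (\<lambda>l. f ` set l) ` set (filter (\<lambda>l. P (f ` set l)) halves)"
    then obtain l where l: "l \<in> set halves" "P (f ` set l)" "A = f ` set l" by auto
    moreover have "card (f ` set l) = 4"
      using card_set[OF l(1)] inj halves_subset[OF l(1)] by (metis card_image inj_on_subset)
    ultimately show "A \<in> {A \<in> [V]\<^bsup>4\<^esup>. P A}"
      using halves_subset[OF l(1)] im by (auto simp: nsets_def)
  qed
  then have "card {A \<in> [V]\<^bsup>4\<^esup>. P A} = card ((\<lambda>l. f ` set l) ` set (filter (\<lambda>l. P (f ` set l)) halves))"
    by (rule arg_cong)
  also have "\<dots> = card (set (filter (\<lambda>l. P (f ` set l)) halves))"
    using inj' by (intro card_image) (rule inj_on_subset, auto)
  also have "\<dots> = length (filter (\<lambda>l. P (f ` set l)) halves)"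
    using dist by (intro distinct_card) simp
  finally show ?thesis .
qed

text \<open>Gives any chosen distinct vertices the first numbers, so that tables for fixed small
  numbers apply to arbitrary edges.\<close>

lemma exists_numbering:
  assumes "card V = n" "0 < n" "distinct xs" "set xs \<subseteq> V"
  obtains f where "bij_betw f {..<n} V" "\<And>i. i < length xs \<Longrightarrow> f i = xs ! i"
proof -
  have "finite V" using assms by (simp add: card_ge_0_finite)
  then obtain ys where ys: "set ys = V - set xs" "distinct ys"
    using finite_distinct_list by (metis finite_Diff)
  then have "distinct (xs @ ys)" "set (xs @ ys) = V" using assms by auto
  moreover from this have "length (xs @ ys) = n" using assms by (metis distinct_card)
  ultimately have "bij_betw ((!) (xs @ ys)) {..<n} V" by (intro bij_betw_nth) auto
  then show thesis by (rule that) (simp add: nth_append)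
qed

text \<open>Up to renaming vertices there are only two pairs of distinct edges, which is why the
  tables come in two versions.\<close>

lemma two_edges_cases:
  assumes V: "card V = 8" and e: "e \<in> complete_graph V" "e' \<in> complete_graph V" "e \<noteq> e'"
  obtains
    (cherry) f where "bij_betw f {..<8} V" "e = edge f (0,1)" "e' = edge f (0,2)" "e \<inter> e' \<noteq> {}"
  | (matching) f where "bij_betw f {..<8} V" "e = edge f (0,1)" "e' = edge f (2,3)" "e \<inter> e' = {}"
proof (cases "e \<inter> e' = {}")
  case True
  obtain x y where xy: "e = {x, y}" "x \<in> V" "y \<in> V" "x \<noteq> y" using e(1) by (rule nsets2_E)
  obtain u v where uv: "e' = {u, v}" "u \<in> V" "v \<in> V" "u \<noteq> v" using e(2) by (rule nsets2_E)
  obtain f where f: "bij_betw f {..<8} V" "\<And>i. i < length [x, y, u, v] \<Longrightarrow> f i = [x, y, u, v] ! i"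
    by (rule exists_numbering[OF V, of "[x, y, u, v]"]) (use xy uv True in auto)
  have "f 0 = x" "f 1 = y" "f 2 = u" "f 3 = v"
    using f(2)[of 0] f(2)[of 1] f(2)[of 2] f(2)[of 3] by simp_all
  then show thesis using matching[OF f(1)] xy uv True by (simp add: edge_def)
next
  case False
  then obtain x where x: "x \<in> e" "x \<in> e'" by auto
  obtain y where y: "e = {x, y}" "x \<in> V" "y \<in> V" "x \<noteq> y"
    using e(1) x(1) by (elim nsets2_E) auto
  obtain z where z: "e' = {x, z}" "z \<in> V" "x \<noteq> z"
    using e(2) x(2) by (elim nsets2_E) auto
  obtain f where f: "bij_betw f {..<8} V" "\<And>i. i < length [x, y, z] \<Longrightarrow> f i = [x, y, z] ! i"
    by (rule exists_numbering[OF V, of "[x, y, z]"]) (use y z e(3) in auto)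
  have "f 0 = x" "f 1 = y" "f 2 = z"
    using f(2)[of 0] f(2)[of 1] f(2)[of 2] by simp_all
  then show thesis using cherry[OF f(1)] y z False by (simp add: edge_def)
qed

section \<open>Numbers of balanced cuts with no or one crossing edge\<close>

definition cut_count :: "'a set \<Rightarrow> nat \<Rightarrow> 'a set set \<Rightarrow> nat" where
  "cut_count V k S = card {A \<in> [V]\<^bsup>4\<^esup>. card (S \<inter> cut_edges V A) = k}"

lemma cut_count_edge:
  assumes f: "bij_betw f {..<8} V" and p: "p \<in> set slots"
  shows "cut_count V 0 {edge f p} = length (filter (\<lambda>l. \<not> crosses p l) halves)"
    and "cut_count V 1 {edge f p} = length (filter (\<lambda>l. crosses p l) halves)"
proof -
  have "{a} \<inter> C = (if a \<in> C then {a} else {})" for a and C :: "'a set set" by auto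
  then have "cut_count V 0 {edge f p} = card {A \<in> [V]\<^bsup>4\<^esup>. edge f p \<notin> cut_edges V A}"
    "cut_count V 1 {edge f p} = card {A \<in> [V]\<^bsup>4\<^esup>. edge f p \<in> cut_edges V A}"
    unfolding cut_count_def by (auto intro!: arg_cong[where f = card])
  then show "cut_count V 0 {edge f p} = length (filter (\<lambda>l. \<not> crosses p l) halves)"
    "cut_count V 1 {edge f p} = length (filter (\<lambda>l. crosses p l) halves)"
    by (simp_all only: card_halves[OF f]) (simp_all add: crosses_iff[OF f] p cong: filter_cong)
qed

lemma cut_count_single:
  assumes V: "card V = 8" and e: "e \<in> complete_graph V"
  shows "cut_count V 0 {e} = 30" "cut_count V 1 {e} = 40"
proof -
  obtain x y where xy: "e = {x, y}" "x \<in> V" "y \<in> V" "x \<noteq> y" using e by (rule nsets2_E)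
  obtain f where f: "bij_betw f {..<8} V" "\<And>i. i < length [x, y] \<Longrightarrow> f i = [x, y] ! i"
    by (rule exists_numbering[OF V, of "[x, y]"]) (use xy in auto)
  have e_eq: "e = edge f (0,1)" using xy f(2)[of 0] f(2)[of 1] by (simp add: edge_def)
  have slot: "(0,1) \<in> set slots" by (simp add: set_slots)
  show "cut_count V 0 {e} = 30" "cut_count V 1 {e} = 40"
    unfolding e_eq cut_count_edge[OF f(1) slot] counts_edge by (rule refl)+
qed

lemma cut_count_pair:
  assumes f: "bij_betw f {..<8} V" and p: "p \<in> set slots" "q \<in> set slots" "p \<noteq> q"
  shows "cut_count V 0 {edge f p, edge f q}
       = length (filter (\<lambda>l. \<not> crosses p l \<and> \<not> crosses q l) halves)"
    and "cut_count V 1 {edge f p, edge f q}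
       = length (filter (\<lambda>l. crosses p l \<noteq> crosses q l) halves)"
proof -
  have ne: "edge f p \<noteq> edge f q"
    using inj_on_edge[of f] f p by (auto simp: bij_betw_def inj_on_eq_iff)
  have "{a, b} \<inter> C = (if a \<in> C then {a} else {}) \<union> (if b \<in> C then {b} else {})" for a b and C :: "'a set set"
    by auto
  then have "cut_count V 0 {edge f p, edge f q}
        = card {A \<in> [V]\<^bsup>4\<^esup>. edge f p \<notin> cut_edges V A \<and> edge f q \<notin> cut_edges V A}"
    "cut_count V 1 {edge f p, edge f q}
        = card {A \<in> [V]\<^bsup>4\<^esup>. (edge f p \<in> cut_edges V A) \<noteq> (edge f q \<in> cut_edges V A)}"
    unfolding cut_count_def using ne by (auto intro!: arg_cong[where f = card])
  then show "cut_count V 0 {edge f p, edge f q}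
       = length (filter (\<lambda>l. \<not> crosses p l \<and> \<not> crosses q l) halves)"
    "cut_count V 1 {edge f p, edge f q}
       = length (filter (\<lambda>l. crosses p l \<noteq> crosses q l) halves)"
    by (simp_all only: card_halves[OF f]) (simp_all add: crosses_iff[OF f] p cong: filter_cong)
qed

lemma finite_balanced: "card V = 8 \<Longrightarrow> finite {A \<in> [V]\<^bsup>4\<^esup>. P A}"
  by (simp add: finite_imp_finite_nsets card_ge_0_finite)

text \<open>A cut that no edge of \<open>S\<close> crosses is crossed by no edge of a subset of
  \<open>S\<close>, so the tables for two or three edges bound \<open>n0\<close> for all larger
  graphs.\<close>

lemma cut_count_zero_le:
  assumes V: "card V = 8" and f: "bij_betw f {..<8} V" and S: "finite S"
    and p: "set ps \<subseteq> set slots" "edge f ` set ps \<subseteq> S"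
  shows "cut_count V 0 S \<le> length (filter (\<lambda>l. \<forall>p\<in>set ps. \<not> crosses p l) halves)"
proof -
  have "cut_count V 0 S \<le> card {A \<in> [V]\<^bsup>4\<^esup>. \<forall>p\<in>set ps. edge f p \<notin> cut_edges V A}"
    unfolding cut_count_def using S p(2) by (intro card_mono finite_balanced[OF V]) auto
  also have "\<dots> = length (filter (\<lambda>l. \<forall>p\<in>set ps. edge f p \<notin> cut_edges V (f ` set l)) halves)"
    by (rule card_halves[OF f])
  also have "\<dots> = length (filter (\<lambda>l. \<forall>p\<in>set ps. \<not> crosses p l) halves)"
    using p(1) by (intro arg_cong[where f = length] filter_cong refl ball_cong) (auto simp: crosses_iff[OF f])
  finally show ?thesis .
qed

lemma few_crossings_rows:
  "few_crossings (row p) (row q) (row r) (row s)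
   = length (filter (\<lambda>l. at_most_one (crosses p l) (crosses q l) (crosses r l) (crosses s l)) halves)"
proof -
  have zip: "zip (map g xs) (map h xs) = map (\<lambda>x. (g x, h x)) xs"
    for g :: "nat list \<Rightarrow> bool" and h :: "nat list \<Rightarrow> 'c" and xs
    by (induction xs) auto
  show ?thesis by (simp add: few_crossings_def row_def zip filter_map comp_def)
qed

lemma sorted_wrt_either:
  assumes "sorted_wrt P xs" "x \<in> set xs" "y \<in> set xs" "x \<noteq> y"
  shows "P x y \<or> P y x"
  using assms by (induction xs) auto

text \<open>If at most one edge of \<open>S\<close> crosses a cut, then so does at most one of any
  four edges of \<open>S\<close>. The cuts for \<open>n0\<close> and \<open>n1\<close> are disjoint
  classes, so one cardinality bounds the sum of both.\<close>

lemma cut_count_le_few_crossings: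
  assumes V: "card V = 8" and f: "bij_betw f {..<8} V" and S: "finite S"
    and p: "distinct [p, q, r, s]" "set [p, q, r, s] \<subseteq> set slots" "edge f ` set [p, q, r, s] \<subseteq> S"
  shows "cut_count V 0 S + cut_count V 1 S \<le> few_crossings (row p) (row q) (row r) (row s)"
proof -
  let ?c = "\<lambda>p A. edge f p \<in> cut_edges V A"
  have inj: "inj_on (edge f) (set slots)" using f by (auto simp: bij_betw_def intro: inj_on_edge)
  have "cut_count V 0 S + cut_count V 1 S
      = card ({A \<in> [V]\<^bsup>4\<^esup>. card (S \<inter> cut_edges V A) = 0} \<union> {A \<in> [V]\<^bsup>4\<^esup>. card (S \<inter> cut_edges V A) = 1})"
    unfolding cut_count_def by (rule card_Un_disjoint[symmetric]) (auto intro: finite_balanced[OF V])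
  also have "\<dots> \<le> card {A \<in> [V]\<^bsup>4\<^esup>. at_most_one (?c p A) (?c q A) (?c r A) (?c s A)}"
  proof (intro card_mono finite_balanced[OF V] subsetI)
    fix A assume A: "A \<in> {A \<in> [V]\<^bsup>4\<^esup>. card (S \<inter> cut_edges V A) = 0} \<union> {A \<in> [V]\<^bsup>4\<^esup>. card (S \<inter> cut_edges V A) = 1}"
    have le: "card (S \<inter> cut_edges V A) \<le> 1" using A by auto
    have two: "\<not> (?c a A \<and> ?c b A)" if "a \<in> set [p, q, r, s]" "b \<in> set [p, q, r, s]" "a \<noteq> b" for a b
    proof
      assume "?c a A \<and> ?c b A"
      then have "{edge f a, edge f b} \<subseteq> S \<inter> cut_edges V A" using that p(3) by auto
      moreover have "edge f a \<noteq> edge f b" using inj that p(2) by (metis inj_on_eq_iff subsetD)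
      ultimately have "2 \<le> card (S \<inter> cut_edges V A)"
        using S card_mono[of "S \<inter> cut_edges V A" "{edge f a, edge f b}"] by simp
      with le show False by simp
    qed
    have "at_most_one (?c p A) (?c q A) (?c r A) (?c s A)"
      using two[of p q] two[of p r] two[of p s] two[of q r] two[of q s] two[of r s] p(1)
      by (simp add: at_most_one_def)
    with A show "A \<in> {A \<in> [V]\<^bsup>4\<^esup>. at_most_one (?c p A) (?c q A) (?c r A) (?c s A)}" by auto
  qed
  also have "\<dots> = few_crossings (row p) (row q) (row r) (row s)"
    unfolding card_halves[OF f] few_crossings_rows
    using p(2) by (intro arg_cong[where f = length] filter_cong refl) (simp add: crosses_iff[OF f])
  finally show ?thesis .
qed

text \<open>For graphs of even size at least 4 this keeps the coefficient \<open>2 n0 - n1\<close>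
  at or above -18.\<close>

lemma cut_count_four:
  assumes V: "card V = 8" and S: "S \<subseteq> complete_graph V" "4 \<le> card S"
  shows "cut_count V 0 S + cut_count V 1 S \<le> 18"
proof -
  have fin: "finite S" using S(2) by (simp add: card_ge_0_finite)
  obtain T where T: "T \<subseteq> S" "card T = 4" using S(2) by (meson obtain_subset_with_card_n)
  then obtain a b c d where abcd: "T = {a, b, c, d}" "distinct [a, b, c, d]"
    by (auto simp: card_Suc_eq numeral_eq_Suc)
  with T S have ab: "a \<in> complete_graph V" "b \<in> complete_graph V" "a \<noteq> b" by auto
  have main: "cut_count V 0 S + cut_count V 1 S \<le> 18"
    if f: "bij_betw f {..<8} V" and e: "a = edge f p" "b = edge f q" and pq: "p \<in> set slots" "q \<in> set slots"
      and sw: "sorted_wrt (\<lambda>r r'. few_crossings (row p) (row q) r r' \<le> 18)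
         (map row (filter (\<lambda>s. s \<notin> {p, q}) slots))" for f p q
  proof -
    obtain r where r: "r \<in> set slots" "c = edge f r" using edge_in_slots[OF f, of c] abcd T S by auto
    obtain s where s: "s \<in> set slots" "d = edge f s" using edge_in_slots[OF f, of d] abcd T S by auto
    have ne: "distinct [p, q, r, s]" using abcd(2) e r s by auto
    \<comment> \<open>The table contains the two remaining edges in one order only, and it is not
      known in which; both orders bound the count.\<close>
    have "few_crossings (row p) (row q) (row r) (row s) \<le> 18 \<or> few_crossings (row p) (row q) (row s) (row r) \<le> 18"
      using sorted_wrt_either[OF sw[unfolded sorted_wrt_map], of r s] r s ne by auto
    moreover have "cut_count V 0 S + cut_count V 1 S \<le> few_crossings (row p) (row q) (row r) (row s)"
      "cut_count V 0 S + cut_count V 1 S \<le> few_crossings (row p) (row q) (row s) (row r)"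
      using ne pq r s e abcd T(1) by (intro cut_count_le_few_crossings[OF V f fin]; auto)+
    ultimately show ?thesis by linarith
  qed
  from V ab show ?thesis
  proof (cases rule: two_edges_cases)
    case (cherry f)
    show ?thesis by (rule main[OF cherry(1-3) _ _ few_crossings_cherry]) (auto simp: set_slots)
  next
    case (matching f)
    show ?thesis by (rule main[OF matching(1-3) _ _ few_crossings_matching]) (auto simp: set_slots)
  qed
qed

lemma cut_count_zero_disjoint:
  assumes V: "card V = 8" and S: "S \<subseteq> complete_graph V" "3 \<le> card S"
    and e: "a \<in> S" "b \<in> S" "a \<inter> b = {}"
  shows "cut_count V 0 S \<le> 6"
proof -
  have fin: "finite S" using S(2) by (simp add: card_ge_0_finite)
  have ab: "a \<in> complete_graph V" "b \<in> complete_graph V" using e S by auto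
  have "a \<noteq> b" using e ab(1) by (auto elim: nsets2_E)
  obtain c where c: "c \<in> S" "c \<noteq> a" "c \<noteq> b"
  proof -
    have "card {a, b} < card S" using S(2) \<open>a \<noteq> b\<close> by simp
    then have "\<not> S \<subseteq> {a, b}" by (meson card_mono finite.emptyI finite.insertI not_less)
    with that show thesis by auto
  qed
  from V ab \<open>a \<noteq> b\<close> show ?thesis
  proof (cases rule: two_edges_cases)
    case (cherry f)
    with e show ?thesis by simp
  next
    case (matching f)
    obtain r where r: "r \<in> set slots" "c = edge f r" using edge_in_slots[OF matching(1), of c] c S by auto
    have "cut_count V 0 S \<le> length (filter (\<lambda>l. \<forall>p\<in>set [(0,1), (2,3), r]. \<not> crosses p l) halves)"
      using r c e matching by (intro cut_count_zero_le[OF V matching(1) fin]) (auto simp: set_slots)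
    also have "\<dots> \<le> 6"
    proof -
      have "r \<notin> {(0,1), (2,3)}" using r c matching by auto
      with two_free_matching r(1) show ?thesis by (simp del: One_nat_def)
    qed
    finally show ?thesis .
  qed
qed

lemma cut_count_zero_four:
  assumes V: "card V = 8" and S: "S \<subseteq> complete_graph V" "4 \<le> card S"
  shows "cut_count V 0 S \<le> 6"
proof -
  have fin: "finite S" using S(2) by (simp add: card_ge_0_finite)
  obtain T where T: "T \<subseteq> S" "card T = 4" using S(2) by (meson obtain_subset_with_card_n)
  then obtain a b c d where abcd: "T = {a, b, c, d}" "distinct [a, b, c, d]"
    by (auto simp: card_Suc_eq numeral_eq_Suc)
  with T S have ab: "a \<in> complete_graph V" "b \<in> complete_graph V" "a \<noteq> b" by auto
  from V ab show ?thesis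
  proof (cases rule: two_edges_cases)
    case (cherry f)
    \<comment> \<open>At most one of \<open>c\<close> and \<open>d\<close> closes the triangle; the
      other one gives the better bound.\<close>
    obtain e where e: "e \<in> {c, d}" "e \<noteq> edge f (1,2)" using abcd(2) by auto
    obtain r where r: "r \<in> set slots" "e = edge f r"
      using edge_in_slots[OF cherry(1), of e] abcd T S e by auto
    have "cut_count V 0 S \<le> length (filter (\<lambda>l. \<forall>p\<in>set [(0,1), (0,2), r]. \<not> crosses p l) halves)"
      using r e abcd T cherry by (intro cut_count_zero_le[OF V cherry(1) fin]) (auto simp: set_slots)
    also have "\<dots> \<le> 6"
    proof -
      have "r \<notin> {(0,1), (0,2), (1,2)}" using r e abcd(2) cherry by auto
      with two_free_cherry r(1) show ?thesis by (simp del: One_nat_def)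
    qed
    finally show ?thesis .
  next
    case (matching f)
    then show ?thesis using cut_count_zero_disjoint[OF V S(1), of a b] S T abcd by auto
  qed
qed

text \<open>For odd size the coefficient is at least \<open>-2 n0\<close>, so 10 is just good enough
  for -20. A triangle attains this, because no cut is crossed by exactly one of its edges.\<close>

lemma cut_count_zero_meeting:
  assumes V: "card V = 8" and S: "S \<subseteq> complete_graph V" "finite S"
    and e: "a \<in> S" "b \<in> S" "a \<inter> b \<noteq> {}" "a \<noteq> b"
  shows "cut_count V 0 S \<le> 10"
proof -
  have ab: "a \<in> complete_graph V" "b \<in> complete_graph V" using e S by auto
  from V ab e(4) show ?thesis
  proof (cases rule: two_edges_cases)
    case (cherry f)
    have "cut_count V 0 S \<le> length (filter (\<lambda>l. \<forall>p\<in>set [(0,1), (0,2)]. \<not> crosses p l) halves)"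
      using e cherry by (intro cut_count_zero_le[OF V cherry(1) S(2)]) (auto simp: set_slots)
    also have "\<dots> = 10" using counts_cherry(1) by (simp del: One_nat_def)
    finally show ?thesis .
  next
    case (matching f)
    with e show ?thesis by simp
  qed
qed

section \<open>Bounds for the coefficients\<close>

definition cut_weight :: "'a set \<Rightarrow> 'a set set \<Rightarrow> real" where
  "cut_weight V S = (- 1) ^ card S * (2 * real (cut_count V 0 S) - real (cut_count V 1 S))"

lemma cut_weight_empty:
  assumes "card V = 8"
  shows "cut_weight V {} = 140"
proof -
  have "(8 choose 4) = (70::nat)" by code_simp
  then show ?thesis using assms by (simp add: cut_weight_def cut_count_def)
qed

text \<open>Sizes 1 and 2 are computed exactly. Beyond that parity decides: for even size, hence at
  least 4, \<open>2 n0 - n1\<close> only needs \<open>n1 <= 18\<close>; for odd size,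
  \<open>n1 - 2 n0\<close> only needs \<open>n0 <= 10\<close>, or \<open>n0 <= 6\<close> for the
  strict bound. The strict bound serves the case of equality.\<close>

lemma cut_weight_bounds:
  assumes V: "card V = 8" and S: "S \<subseteq> complete_graph V" "S \<noteq> {}"
  shows "- 20 \<le> cut_weight V S"
    and "4 \<le> card S \<or> (\<exists>a\<in>S. \<exists>b\<in>S. a \<inter> b = {}) \<Longrightarrow> - 20 < cut_weight V S"
proof -
  have "finite V" using V by (simp add: card_ge_0_finite)
  then have fin: "finite S" using S(1) finite_imp_finite_nsets finite_subset by blast
  let ?D = "\<exists>a\<in>S. \<exists>b\<in>S. a \<inter> b = {}"
  have nonempty: "a \<noteq> {}" if "a \<in> S" for a using that S(1) by (auto elim: nsets2_E)
  have "0 < card S" using S fin by (simp add: card_gt_0_iff)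
  then consider "card S = 1" | "card S = 2" | "3 \<le> card S" by linarith
  then have "- 20 \<le> cut_weight V S \<and> (4 \<le> card S \<or> ?D \<longrightarrow> - 20 < cut_weight V S)"
  proof cases
    case 1
    then obtain e where e: "S = {e}" by (auto simp: card_1_singleton_iff)
    then have "cut_weight V S = - 20" using cut_count_single[OF V, of e] S by (simp add: cut_weight_def)
    moreover have "\<not> ?D" using nonempty e by auto
    ultimately show ?thesis using 1 by simp
  next
    case 2
    then obtain a b where ab: "S = {a, b}" "a \<noteq> b" by (auto simp: card_2_iff)
    with S have "a \<in> complete_graph V" "b \<in> complete_graph V" by auto
    from V this ab(2) show ?thesis
    proof (cases rule: two_edges_cases)
      case (cherry f)
      then have "cut_weight V S = - 20"
        using cut_count_pair[OF cherry(1), of "(0,1)" "(0,2)"] 2 ab counts_cherry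
        by (simp add: cut_weight_def set_slots del: One_nat_def)
      moreover have "\<not> ?D" using nonempty ab cherry(4) by auto
      ultimately show ?thesis using 2 by simp
    next
      case (matching f)
      then have "cut_weight V S = - 4"
        using cut_count_pair[OF matching(1), of "(0,1)" "(2,3)"] 2 ab counts_matching
        by (simp add: cut_weight_def set_slots del: One_nat_def)
      then show ?thesis by simp
    qed
  next
    case 3
    have small: "cut_count V 0 S \<le> 6" if "4 \<le> card S \<or> ?D"
      using that cut_count_zero_four[OF V S(1)] cut_count_zero_disjoint[OF V S(1) 3] by blast
    have "cut_count V 0 S \<le> 10"
    proof (cases ?D)
      case True
      with small show ?thesis by simp
    next
      case False
      obtain T where "T \<subseteq> S" "card T = 2" using 3 obtain_subset_with_card_n[of 2 S] by auto
      then obtain a b where "a \<in> S" "b \<in> S" "a \<noteq> b" by (auto simp: card_2_iff)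
      with False show ?thesis using cut_count_zero_meeting[OF V S(1) fin, of a b] by auto
    qed
    show ?thesis
    proof (cases "even (card S)")
      case True
      with 3 have "4 \<le> card S" by presburger
      then have "cut_count V 1 S \<le> 18" using cut_count_four[OF V S(1)] by simp
      with True show ?thesis by (simp add: cut_weight_def)
    next
      case False
      have "- 20 \<le> cut_weight V S"
        using False \<open>cut_count V 0 S \<le> 10\<close> by (simp add: cut_weight_def)
      moreover have "- 20 < cut_weight V S" if "4 \<le> card S \<or> ?D"
        using False small[OF that] by (simp add: cut_weight_def)
      ultimately show ?thesis by blast
    qed
  qed
  then show "- 20 \<le> cut_weight V S"
    and "4 \<le> card S \<or> ?D \<Longrightarrow> - 20 < cut_weight V S" by blast+
qed

section \<open>The upper bound\<close>

lemma bipartite_cut_edges: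
  assumes "A \<subseteq> V" "G \<subseteq> cut_edges V A"
  shows "bipartite V G"
  unfolding bipartite_def
proof (intro exI conjI ballI)
  show "A \<union> (V - A) = V" "A \<inter> (V - A) = {}" using assms(1) by auto
  fix e assume "e \<in> G"
  then have e: "e \<in> cut_edges V A" using assms(2) by auto
  then obtain x y where xy: "e = {x, y}" "x \<in> V" "y \<in> V" "x \<noteq> y"
    by (auto simp: cut_edges_def elim: nsets2_E)
  with e consider "x \<in> A" "y \<in> V - A" | "y \<in> A" "x \<in> V - A"
    by (auto simp: doubleton_in_cut_edges)
  then show "\<exists>x\<in>A. \<exists>y\<in>V - A. e = {x, y}"
    using xy(1) by cases (auto simp: insert_commute)
qed

text \<open>The sum of \<open>cut_relation\<close> over all \<open>A\<close> of four vertices; an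
  agreement inside the cut of \<open>A\<close> would be bipartite.\<close>

lemma sum_cut_weight:
  assumes V: "card V = 8" and F: "F \<subseteq> Pow (complete_graph V)" and nb: "non_bipartite_agreeing V F"
  shows "(\<Sum>S\<in>Pow (complete_graph V). cut_weight V S * (hat F S)\<^sup>2) = 0"
proof -
  let ?E = "complete_graph V" and ?\<phi> = "\<lambda>J. 2 * of_bool (card J = 0) - of_bool (card J = 1) :: real"
  have finV: "finite V" using V by (simp add: card_ge_0_finite)
  then have fin4: "finite ([V]\<^bsup>4\<^esup>)" by (rule finite_imp_finite_nsets)
  have weight: "cut_weight V S = (\<Sum>A\<in>[V]\<^bsup>4\<^esup>. ?\<phi> (S \<inter> cut_edges V A) * (-1) ^ card S)" for S
  proof -
    have "(\<Sum>A\<in>[V]\<^bsup>4\<^esup>. of_bool (card (S \<inter> cut_edges V A) = k)) = real (cut_count V k S)" for k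
      using fin4 by (simp add: cut_count_def sum_of_bool_eq Int_def)
    then have "(\<Sum>A\<in>[V]\<^bsup>4\<^esup>. ?\<phi> (S \<inter> cut_edges V A)) = 2 * real (cut_count V 0 S) - real (cut_count V 1 S)"
      by (simp only: sum_subtractf sum_distrib_left[symmetric])
    then show ?thesis
      unfolding cut_weight_def sum_distrib_right[symmetric] by (simp only: mult.commute)
  qed
  have "(\<Sum>S\<in>Pow ?E. cut_weight V S * (hat F S)\<^sup>2)
      = (\<Sum>S\<in>Pow ?E. \<Sum>A\<in>[V]\<^bsup>4\<^esup>. ?\<phi> (S \<inter> cut_edges V A) * (-1) ^ card S * (hat F S)\<^sup>2)"
    by (simp only: weight sum_distrib_right)
  also have "\<dots> = (\<Sum>A\<in>[V]\<^bsup>4\<^esup>. \<Sum>S\<in>Pow ?E. ?\<phi> (S \<inter> cut_edges V A) * (-1) ^ card S * (hat F S)\<^sup>2)"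
    by (rule sum.swap)
  also have "\<dots> = (\<Sum>A\<in>[V]\<^bsup>4\<^esup>. 0)"
  proof (intro sum.cong refl cut_relation finV F)
    fix A assume A: "A \<in> [V]\<^bsup>4\<^esup>"
    show "cut_edges V A \<subseteq> ?E" by (auto simp: cut_edges_def)
    fix G G' assume "G \<in> F" "G' \<in> F"
    then show "\<not> agreement V G G' \<subseteq> cut_edges V A"
      using nb A bipartite_cut_edges unfolding non_bipartite_agreeing_def nsets_def by blast
  qed
  finally show ?thesis by simp
qed

text \<open>Hoffman's argument: add 20 times Parseval's identity to the weighted relation and move
  the term of \<open>{}\<close>, with coefficient \<open>140 + 20\<close>, to the other side. The
  exponent 25 arises from \<open>20 * 2^28 = 160 * 2^25\<close>.\<close>

lemma sum_excess:
  assumes V: "card V = 8" and F: "F \<subseteq> Pow (complete_graph V)" and nb: "non_bipartite_agreeing V F"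
  shows "(\<Sum>S\<in>Pow (complete_graph V) - {{}}. (cut_weight V S + 20) * (hat F S)\<^sup>2)
       = 160 * real (card F) * (2 ^ 25 - real (card F))"
proof -
  let ?E = "complete_graph V"
  have finE: "finite ?E" using V by (simp add: finite_imp_finite_nsets card_ge_0_finite)
  have "(8 choose 2) = (28::nat)" by code_simp
  then have cardE: "card ?E = 28" using V by simp
  have "(\<Sum>S\<in>Pow ?E - {{}}. (cut_weight V S + 20) * (hat F S)\<^sup>2)
      = (\<Sum>S\<in>Pow ?E. (cut_weight V S + 20) * (hat F S)\<^sup>2) - (cut_weight V {} + 20) * (hat F {})\<^sup>2"
    using finE by (subst sum_diff1) auto
  also have "(\<Sum>S\<in>Pow ?E. (cut_weight V S + 20) * (hat F S)\<^sup>2) = 20 * (2 ^ 28 * real (card F))"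
    using sum_cut_weight[OF assms] sum_hat_square[OF finE F] cardE
    by (simp add: distrib_right sum.distrib sum_distrib_left[symmetric])
  finally show ?thesis
    by (simp add: cut_weight_empty[OF V] power2_eq_square algebra_simps)
qed

text \<open>All summands in \<open>sum_excess\<close> are nonnegative, which bounds
  \<open>card F\<close>. If equality holds, every summand is zero, so \<open>hat F S\<close>
  vanishes wherever the coefficient exceeds -20.\<close>

lemma card_le_and_hat_zero:
  assumes V: "card V = 8" and F: "F \<subseteq> Pow (complete_graph V)" and nb: "non_bipartite_agreeing V F"
  shows "card F \<le> 2 ^ 25"
    and "card F = 2 ^ 25 \<Longrightarrow> S \<subseteq> complete_graph V \<Longrightarrow>
           4 \<le> card S \<or> (\<exists>a\<in>S. \<exists>b\<in>S. a \<inter> b = {}) \<Longrightarrow> hat F S = 0"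
proof -
  let ?E = "complete_graph V"
  have finE: "finite ?E" using V by (simp add: finite_imp_finite_nsets card_ge_0_finite)
  have nonneg: "0 \<le> (cut_weight V S + 20) * (hat F S)\<^sup>2" if "S \<in> Pow ?E - {{}}" for S
    using cut_weight_bounds(1)[OF V, of S] that by simp
  have "0 \<le> (\<Sum>S\<in>Pow ?E - {{}}. (cut_weight V S + 20) * (hat F S)\<^sup>2)"
    using nonneg by (rule sum_nonneg)
  then have "0 \<le> real (card F) * (2 ^ 25 - real (card F))"
    unfolding sum_excess[OF assms] by simp
  then have "real (card F) \<le> 2 ^ 25"
    by (cases "card F = 0") (auto simp: zero_le_mult_iff)
  then show "card F \<le> 2 ^ 25" by simp
  assume eq: "card F = 2 ^ 25" and S: "S \<subseteq> ?E" and big: "4 \<le> card S \<or> (\<exists>a\<in>S. \<exists>b\<in>S. a \<inter> b = {})"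
  have "S \<noteq> {}" using big by auto
  have "(\<Sum>S\<in>Pow ?E - {{}}. (cut_weight V S + 20) * (hat F S)\<^sup>2) = 0"
    unfolding sum_excess[OF assms] eq by simp
  then have "(cut_weight V S + 20) * (hat F S)\<^sup>2 = 0"
    using nonneg finE S \<open>S \<noteq> {}\<close> by (subst (asm) sum_nonneg_eq_0_iff) auto
  then show "hat F S = 0"
    using cut_weight_bounds(2)[OF V S \<open>S \<noteq> {}\<close> big] by simp
qed

section \<open>Functions of low degree on the cube\<close>

lemma sum_Pow_insert:
  assumes "finite E" "e \<notin> E"
  shows "(\<Sum>S\<in>Pow (insert e E). h S) = (\<Sum>S\<in>Pow E. h S + h (insert e S))"
proof -
  have "Pow E \<inter> insert e ` Pow E = {}" using assms(2) by auto
  moreover have "inj_on (insert e) (Pow E)"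
    using assms(2) by (intro inj_onI) (metis Pow_iff insert_ident subsetD)
  ultimately show ?thesis
    using assms(1) by (simp add: Pow_insert sum.union_disjoint sum.reindex sum.distrib)
qed

lemma character_insert_left:
  assumes "finite S" "e \<notin> S"
  shows "character (insert e S) G = (if e \<in> G then - 1 else 1) * character S G"
  using assms by (simp add: character_def)

lemma character_insert_right:
  assumes "e \<notin> S"
  shows "character S (insert e G) = character S G"
  unfolding character_def using assms by (intro prod.cong) auto

text \<open>Restricts a Fourier sum to the two facets of the cube in direction \<open>e\<close>,
  where the character of \<open>insert e S\<close> is plus or minus that of
  \<open>S\<close>.\<close>

lemma sum_character_insert:
  assumes "finite E" "e \<notin> E" "G \<subseteq> E"
  shows "(\<Sum>S\<in>Pow (insert e E). c S * character S G)
       = (\<Sum>S\<in>Pow E. (c S + c (insert e S)) * character S G)"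
    and "(\<Sum>S\<in>Pow (insert e E). c S * character S (insert e G))
       = (\<Sum>S\<in>Pow E. (c S - c (insert e S)) * character S G)"
proof -
  have S: "finite S" "e \<notin> S" if "S \<in> Pow E" for S using that assms finite_subset by auto
  have "e \<notin> G" using assms by auto
  then show "(\<Sum>S\<in>Pow (insert e E). c S * character S G)
       = (\<Sum>S\<in>Pow E. (c S + c (insert e S)) * character S G)"
    unfolding sum_Pow_insert[OF assms(1,2)]
    by (intro sum.cong refl) (simp add: character_insert_left S algebra_simps)
  show "(\<Sum>S\<in>Pow (insert e E). c S * character S (insert e G))
       = (\<Sum>S\<in>Pow E. (c S - c (insert e S)) * character S G)"
    unfolding sum_Pow_insert[OF assms(1,2)]
    by (intro sum.cong refl) (simp add: character_insert_left character_insert_right S algebra_simps)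
qed

lemma card_Collect_Pow_insert:
  assumes "finite E" "e \<notin> E"
  shows "card {G \<in> Pow (insert e E). P G} = card {G \<in> Pow E. P G} + card {G \<in> Pow E. P (insert e G)}"
proof -
  have fin: "finite (Pow E)" using assms by simp
  have "{G \<in> Pow (insert e E). P G} = {G \<in> Pow E. P G} \<union> insert e ` {G \<in> Pow E. P (insert e G)}"
    by (auto simp: Pow_insert)
  moreover have "{G \<in> Pow E. P G} \<inter> insert e ` {G \<in> Pow E. P (insert e G)} = {}"
    using assms(2) by auto
  moreover have "inj_on (insert e) {G \<in> Pow E. P (insert e G)}"
    using assms(2) by (intro inj_onI) (metis (no_types, lifting) Pow_iff insert_ident mem_Collect_eq subsetD)
  ultimately show ?thesis
    using fin by (simp add: card_Un_disjoint card_image)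
qed

text \<open>Induction on the dimension, splitting the cube into two facets. If the function is
  nonzero somewhere on both, the bound for degree \<open>d\<close> on each facet adds up. Otherwise
  the nonzero facet alone satisfies the bound for degree \<open>d - 1\<close>, which is twice as
  good.\<close>

lemma support_low_degree:
  fixes c :: "'b set \<Rightarrow> real"
  assumes "finite E" "\<And>S. S \<subseteq> E \<Longrightarrow> d < card S \<Longrightarrow> c S = 0"
    "G0 \<subseteq> E" "(\<Sum>S\<in>Pow E. c S * character S G0) \<noteq> 0"
  shows "2 ^ card E \<le> 2 ^ d * card {G \<in> Pow E. (\<Sum>S\<in>Pow E. c S * character S G) \<noteq> 0}"
  using assms
proof (induction E arbitrary: c d G0 rule: finite_induct)
  case empty
  have "{G \<in> Pow {}. (\<Sum>S\<in>Pow {}. c S * character S G) \<noteq> 0} = {{}}"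
    using empty.prems by auto
  then show ?case by simp
next
  case (insert e E)
  let ?h = "\<lambda>c G. \<Sum>S\<in>Pow E. c S * character S G"
  let ?c0 = "\<lambda>S. c S + c (insert e S)" and ?c1 = "\<lambda>S. c S - c (insert e S)"
  let ?N = "\<lambda>c. card {G \<in> Pow E. ?h c G \<noteq> 0}"
  have card_ins: "card (insert e S) = Suc (card S)" if "S \<subseteq> E" for S
    using that insert.hyps finite_subset by (subst card_insert_disjoint) auto
  have van: "c S = 0" "c (insert e S) = 0" if "S \<subseteq> E" "d < card S" for S
    using that insert.prems(1)[of S] insert.prems(1)[of "insert e S"] card_ins[of S] by auto
  have van': "c (insert e S) = 0" if "S \<subseteq> E" "d < Suc (card S)" for S
    using that insert.prems(1)[of "insert e S"] card_ins[of S] by auto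
  have count: "card {G \<in> Pow (insert e E). (\<Sum>S\<in>Pow (insert e E). c S * character S G) \<noteq> 0} = ?N ?c0 + ?N ?c1"
  proof -
    have "{G \<in> Pow E. (\<Sum>S\<in>Pow (insert e E). c S * character S G) \<noteq> 0} = {G \<in> Pow E. ?h ?c0 G \<noteq> 0}"
      "{G \<in> Pow E. (\<Sum>S\<in>Pow (insert e E). c S * character S (insert e G)) \<noteq> 0} = {G \<in> Pow E. ?h ?c1 G \<noteq> 0}"
      using sum_character_insert[OF insert.hyps] by auto
    then show ?thesis by (simp only: card_Collect_Pow_insert[OF insert.hyps])
  qed
  have some: "\<exists>G\<subseteq>E. ?h ?c0 G \<noteq> 0 \<or> ?h ?c1 G \<noteq> 0"
  proof (cases "e \<in> G0")
    case True
    define G where "G = G0 - {e}"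
    have G: "G0 = insert e G" "G \<subseteq> E" using True insert.prems(2) by (auto simp: G_def)
    have "?h ?c1 G \<noteq> 0"
      using insert.prems(3) unfolding G(1) sum_character_insert(2)[OF insert.hyps G(2)] .
    with G(2) show ?thesis by blast
  next
    case False
    then have G: "G0 \<subseteq> E" using insert.prems(2) by auto
    have "?h ?c0 G0 \<noteq> 0"
      using insert.prems(3) unfolding sum_character_insert(1)[OF insert.hyps G] .
    with G show ?thesis by blast
  qed
  have lower: "2 ^ card E \<le> 2 ^ k * ?N b"
    if "\<And>S. S \<subseteq> E \<Longrightarrow> k < card S \<Longrightarrow> b S = 0" "G \<subseteq> E" "?h b G \<noteq> 0" for b k G
    using that by (rule insert.IH)
  text \<open>If one half of the function vanishes, the other half is a difference of the two halves,
    which has smaller degree.\<close>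
  have half: "2 ^ Suc (card E) \<le> 2 ^ d * card {G \<in> Pow E. g G \<noteq> 0}"
    if g: "\<And>G. G \<subseteq> E \<Longrightarrow> g G = ?h (\<lambda>S. r * c (insert e S)) G" and G: "G \<subseteq> E" "g G \<noteq> 0" for g r G
  proof (cases d)
    \<comment> \<open>No smaller degree is available here, but then all coefficients of sets
      containing \<open>e\<close> vanish, contradicting \<open>g G\<close> being nonzero.\<close>
    case 0
    then have "?h (\<lambda>S. r * c (insert e S)) G = 0" using van' by (intro sum.neutral) auto
    with G g[of G] show ?thesis by simp
  next
    case (Suc d')
    have "2 ^ card E \<le> 2 ^ d' * ?N (\<lambda>S. r * c (insert e S))"
      using van' Suc G g[of G] by (intro lower[of d' _ G]) auto
    also have "{G \<in> Pow E. ?h (\<lambda>S. r * c (insert e S)) G \<noteq> 0} = {G \<in> Pow E. g G \<noteq> 0}"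
      using g by (intro Collect_cong conj_cong) auto
    finally show ?thesis using Suc by simp
  qed
  \<comment> \<open>The difference of the facets only involves sets containing \<open>e\<close>,
    whose size drops by one when \<open>e\<close> is removed. The factor \<open>r\<close> in
    \<open>half\<close> is 2 or -2, depending on which facet vanishes.\<close>
  have diff: "?h ?c0 G - ?h ?c1 G = ?h (\<lambda>S. 2 * c (insert e S)) G" for G
    unfolding sum_subtractf[symmetric] by (intro sum.cong refl) (simp add: algebra_simps)
  have neg: "?h (\<lambda>S. - 2 * c (insert e S)) G = - ?h (\<lambda>S. 2 * c (insert e S)) G" for G
    unfolding sum_negf[symmetric] by (intro sum.cong refl) simp
  consider (both) G0 G1 where "G0 \<subseteq> E" "?h ?c0 G0 \<noteq> 0" "G1 \<subseteq> E" "?h ?c1 G1 \<noteq> 0"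
    | (one) "\<And>G. G \<subseteq> E \<Longrightarrow> ?h ?c0 G = 0" | (zero) "\<And>G. G \<subseteq> E \<Longrightarrow> ?h ?c1 G = 0"
    by blast
  then have "2 ^ Suc (card E) \<le> 2 ^ d * (?N ?c0 + ?N ?c1)"
  proof cases
    case both
    have "2 ^ card E \<le> 2 ^ d * ?N ?c0" using van both(1,2) by (intro lower[of d _ G0]) auto
    moreover have "2 ^ card E \<le> 2 ^ d * ?N ?c1" using van both(3,4) by (intro lower[of d _ G1]) auto
    ultimately show ?thesis by (simp add: distrib_left)
  next
    case one
    with some obtain G where G: "G \<subseteq> E" "?h ?c1 G \<noteq> 0" by blast
    have "?h ?c1 G = ?h (\<lambda>S. - 2 * c (insert e S)) G" if "G \<subseteq> E" for G
      using diff[of G] neg[of G] one[OF that] by linarith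
    from half[OF this G] have "2 ^ Suc (card E) \<le> 2 ^ d * ?N ?c1" .
    then show ?thesis by (simp only: distrib_left)
  next
    case zero
    with some obtain G where G: "G \<subseteq> E" "?h ?c0 G \<noteq> 0" by blast
    have "?h ?c0 G = ?h (\<lambda>S. 2 * c (insert e S)) G" if "G \<subseteq> E" for G
      using diff[of G] zero[OF that] by linarith
    from half[OF this G] have "2 ^ Suc (card E) \<le> 2 ^ d * ?N ?c0" .
    then show ?thesis by (simp only: distrib_left)
  qed
  then show ?case unfolding count card_insert_disjoint[OF insert.hyps] .
qed

section \<open>Families of maximum size\<close>

definition toggle :: "'b \<Rightarrow> 'b set \<Rightarrow> 'b set" where
  "toggle e G = sym_diff G {e}"

lemma toggle_subset: "e \<in> E \<Longrightarrow> G \<subseteq> E \<Longrightarrow> toggle e G \<subseteq> E"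
  by (auto simp: toggle_def)

lemma character_toggle:
  assumes "finite S"
  shows "character S (toggle e G) = character S G * (if e \<in> S then - 1 else 1)"
proof -
  have "character S {e} = (if e \<in> S then - 1 else 1)"
    using assms by (simp add: character_def prod.If_cases)
  then show ?thesis using character_mult[OF assms, of G "{e}"] by (simp add: toggle_def)
qed

text \<open>The derivative in \<open>e\<close> has degree at most 2 and is not zero, so at least a
  quarter of the pairs \<open>G\<close>, \<open>insert e G\<close> have exactly one member in
  \<open>F\<close>. Such pairs (\<open>N\<close>) already account for all of \<open>F\<close>, which
  leaves no pair with both members in \<open>F\<close> (\<open>M\<close>).\<close>

lemma toggle_leaves_family:
  assumes fin: "finite E" and F: "F \<subseteq> Pow E" and cardF: "8 * card F = 2 ^ card E"
    and deg: "\<And>S. S \<subseteq> E \<Longrightarrow> 4 \<le> card S \<Longrightarrow> hat F S = 0"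
    and e: "e \<in> E" and dep: "G0 \<subseteq> E" "(G0 \<in> F) \<noteq> (toggle e G0 \<in> F)"
    and G: "G \<in> F"
  shows "toggle e G \<notin> F"
proof -
  define D where "D = E - {e}"
  have D: "E = insert e D" "e \<notin> D" "finite D" using e fin by (auto simp: D_def)
  then have cardE: "card E = Suc (card D)" by simp
  define c where "c S = hat F S / 2 ^ card E" for S
  define N where "N = {G \<in> Pow D. (G \<in> F) \<noteq> (insert e G \<in> F)}"
  define M where "M = {G \<in> Pow D. G \<in> F \<and> insert e G \<in> F}"
  have ind: "(\<Sum>S\<in>Pow E. c S * character S G) = (if G \<in> F then 1 else 0)" if "G \<subseteq> E" for G
    using hat_inversion[OF fin F that] by (simp add: c_def sum_divide_distrib[symmetric])
  \<comment> \<open>The derivative of the indicator function in \<open>e\<close>; its coefficient at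
    \<open>S\<close> comes from \<open>hat F (insert e S)\<close>, which vanishes for
    \<open>card S > 2\<close>.\<close>
  have diff: "(\<Sum>S\<in>Pow D. 2 * c (insert e S) * character S G)
      = (if G \<in> F then 1 else 0) - (if insert e G \<in> F then 1 else 0)" if "G \<subseteq> D" for G
  proof -
    have "G \<subseteq> E" "insert e G \<subseteq> E" using that D(1) by auto
    then have "(if G \<in> F then 1 else 0) - (if insert e G \<in> F then 1 else 0)
        = (\<Sum>S\<in>Pow D. (c S + c (insert e S)) * character S G) - (\<Sum>S\<in>Pow D. (c S - c (insert e S)) * character S G)"
      using sum_character_insert[OF D(3,2) that, of c] ind[of G] ind[of "insert e G"] D(1) by simp
    also have "\<dots> = (\<Sum>S\<in>Pow D. 2 * c (insert e S) * character S G)"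
      unfolding sum_subtractf[symmetric] by (intro sum.cong refl) (simp add: algebra_simps)
    finally show ?thesis by simp
  qed
  have "N \<noteq> {}"
  proof (cases "e \<in> G0")
    case True
    then have "toggle e G0 \<in> Pow D" "insert e (toggle e G0) = G0"
      using dep(1) D by (auto simp: toggle_def)
    with dep(2) show ?thesis by (auto simp: N_def)
  next
    case False
    then have "G0 \<in> Pow D" "insert e G0 = toggle e G0" using dep(1) D by (auto simp: toggle_def)
    with dep(2) show ?thesis by (auto simp: N_def)
  qed
  then obtain G1 where G1: "G1 \<subseteq> D" "(G1 \<in> F) \<noteq> (insert e G1 \<in> F)" by (auto simp: N_def)
  have "2 ^ card D \<le> 2 ^ 2 * card {G \<in> Pow D. (\<Sum>S\<in>Pow D. 2 * c (insert e S) * character S G) \<noteq> 0}"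
  proof (rule support_low_degree[OF D(3) _ G1(1)])
    show "2 * c (insert e S) = 0" if "S \<subseteq> D" "2 < card S" for S
    proof -
      have "card (insert e S) = Suc (card S)"
        using that(1) D finite_subset by (subst card_insert_disjoint) auto
      then show ?thesis using deg[of "insert e S"] that D(1) by (auto simp: c_def)
    qed
    show "(\<Sum>S\<in>Pow D. 2 * c (insert e S) * character S G1) \<noteq> 0"
      unfolding diff[OF G1(1)] using G1(2) by auto
  qed
  also have "{G \<in> Pow D. (\<Sum>S\<in>Pow D. 2 * c (insert e S) * character S G) \<noteq> 0} = N"
    unfolding N_def using diff by (intro Collect_cong conj_cong) auto
  finally have N: "2 ^ card D \<le> 4 * card N" by simp
  have "card F = card {G \<in> Pow E. G \<in> F}" using F by (intro arg_cong[where f = card]) auto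
  also have "\<dots> = card {G \<in> Pow D. G \<in> F} + card {G \<in> Pow D. insert e G \<in> F}"
    unfolding D(1) by (rule card_Collect_Pow_insert[OF D(3,2)])
  also have "\<dots> = card N + 2 * card M"
  proof -
    let ?P = "{G \<in> Pow D. G \<in> F}" and ?Q = "{G \<in> Pow D. insert e G \<in> F}"
    have "finite ?P" "finite ?Q" "finite M" "finite N" using D(3) by (auto simp: M_def N_def)
    then have "card ?P + card ?Q = card (?P \<union> ?Q) + card (?P \<inter> ?Q)" by (intro card_Un_Int)
    also have "?P \<inter> ?Q = M" by (auto simp: M_def)
    also have "?P \<union> ?Q = N \<union> M" by (auto simp: M_def N_def)
    also have "card (N \<union> M) = card N + card M"
      using \<open>finite M\<close> \<open>finite N\<close> by (intro card_Un_disjoint) (auto simp: M_def N_def)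
    finally show ?thesis by simp
  qed
  \<comment> \<open>By \<open>cardF\<close>, \<open>4 * card F = 2 ^ card D <= 4 * card N\<close>,
    while \<open>card F = card N + 2 * card M\<close>.\<close>
  finally have "card M = 0" using N cardF cardE by simp
  then have "M = {}" using D(3) by (simp add: M_def)
  show ?thesis
  proof
    assume t: "toggle e G \<in> F"
    have "G - {e} \<in> M"
    proof (cases "e \<in> G")
      case True
      then have "insert e (G - {e}) = G" "G - {e} = toggle e G" by (auto simp: toggle_def)
      with G t F show ?thesis by (auto simp: M_def D_def)
    next
      case False
      then have "insert e (G - {e}) = toggle e G" "G - {e} = G" by (auto simp: toggle_def)
      with G t F show ?thesis by (auto simp: M_def D_def)
    qed
    with \<open>M = {}\<close> show False by simp
  qed
qed

text \<open>In the mixed second difference in \<open>e\<close> and \<open>e'\<close>, the character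
  of \<open>S\<close> cancels unless \<open>S\<close> contains both, and there the coefficient is
  zero by assumption.\<close>

lemma mixed_difference_zero:
  assumes fin: "finite E" and F: "F \<subseteq> Pow E"
    and e: "e \<in> E" "e' \<in> E" and van: "\<And>S. S \<subseteq> E \<Longrightarrow> e \<in> S \<Longrightarrow> e' \<in> S \<Longrightarrow> hat F S = 0"
    and G: "G \<subseteq> E"
  shows "of_bool (G \<in> F) + of_bool (toggle e' (toggle e G) \<in> F)
       = (of_bool (toggle e G \<in> F) + of_bool (toggle e' G \<in> F) :: real)"
proof -
  have sub: "toggle e G \<subseteq> E" "toggle e' G \<subseteq> E" "toggle e' (toggle e G) \<subseteq> E"
    using e G by (simp_all add: toggle_subset)
  have inv: "(2::real) ^ card E * of_bool (G \<in> F) = (\<Sum>S\<in>Pow E. hat F S * character S G)" if "G \<subseteq> E" for G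
    using hat_inversion[OF fin F that] by (simp add: of_bool_def)
  have "(2::real) ^ card E * (of_bool (G \<in> F) + of_bool (toggle e' (toggle e G) \<in> F)
        - (of_bool (toggle e G \<in> F) + of_bool (toggle e' G \<in> F)))
      = (\<Sum>S\<in>Pow E. hat F S * character S G + hat F S * character S (toggle e' (toggle e G))
          - (hat F S * character S (toggle e G) + hat F S * character S (toggle e' G)))"
    unfolding right_diff_distrib distrib_left inv[OF G] inv[OF sub(1)] inv[OF sub(2)] inv[OF sub(3)]
    by (simp only: sum.distrib sum_subtractf)
  also have "\<dots> = 0"
  proof (intro sum.neutral ballI)
    fix S assume S: "S \<in> Pow E"
    then have "finite S" using fin finite_subset by auto
    then show "hat F S * character S G + hat F S * character S (toggle e' (toggle e G))
          - (hat F S * character S (toggle e G) + hat F S * character S (toggle e' G)) = 0"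
      using van[of S] S by (auto simp: character_toggle)
  qed
  finally show ?thesis by simp
qed

lemma bipartite_star:
  assumes "G \<subseteq> complete_graph V" "\<And>e. e \<in> G \<Longrightarrow> v \<in> e"
  shows "bipartite V G"
\<comment> \<open>The intersection with \<open>V\<close> covers a \<open>v\<close> outside
  \<open>V\<close>; in that case \<open>G\<close> is empty.\<close>
proof (rule bipartite_cut_edges[of "{v} \<inter> V"])
  show "G \<subseteq> cut_edges V ({v} \<inter> V)"
  proof
    fix e assume "e \<in> G"
    then have "e \<in> complete_graph V" "v \<in> e" using assms by auto
    moreover from this have "e \<inter> ({v} \<inter> V) = {v}" by (auto simp: nsets_def)
    ultimately show "e \<in> cut_edges V ({v} \<inter> V)" by (simp add: cut_edges_def)
  qed
qed simp

text \<open>Pairwise intersecting edges form a star or a triangle. Avoiding \<open>x\<close> and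
  then \<open>y\<close> yields the three sides one after the other.\<close>

lemma intersecting_edges_triangle:
  assumes J: "J \<subseteq> complete_graph V" and int: "\<And>e e'. e \<in> J \<Longrightarrow> e' \<in> J \<Longrightarrow> e \<inter> e' \<noteq> {}"
    and star: "\<And>v. \<exists>e\<in>J. v \<notin> e"
  shows "is_triangle V J"
proof -
  obtain e1 where e1: "e1 \<in> J" using star by blast
  then obtain x y where xy: "e1 = {x, y}" "x \<in> V" "y \<in> V" "x \<noteq> y" using J by (blast elim: nsets2_E)
  obtain e2 where e2: "e2 \<in> J" "x \<notin> e2" using star by blast
  then have "y \<in> e2" using int[OF e1 e2(1)] xy by auto
  moreover have "e2 \<in> complete_graph V" using e2 J by auto
  ultimately obtain z where z: "e2 = {y, z}" "z \<in> V" "z \<noteq> y" by (elim nsets2_E) auto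
  then have "z \<noteq> x" using e2 by auto
  obtain e3 where e3: "e3 \<in> J" "y \<notin> e3" using star by blast
  then have "x \<in> e3" "z \<in> e3" using int[OF e1 e3(1)] int[OF e2(1) e3(1)] xy z by auto
  moreover have "e3 \<in> complete_graph V" using e3 J by auto
  ultimately have e3': "e3 = {x, z}" using \<open>z \<noteq> x\<close> by (elim nsets2_E) auto
  have "J = complete_graph {x, y, z}"
  proof (intro equalityI subsetI)
    fix e assume e: "e \<in> J"
    then obtain a b where ab: "e = {a, b}" "a \<noteq> b" using J by (blast elim: nsets2_E)
    \<comment> \<open>An edge that meets all three sides of a triangle contains two of its
      vertices.\<close>
    have "{a, b} \<inter> {x, y} \<noteq> {}" "{a, b} \<inter> {y, z} \<noteq> {}" "{a, b} \<inter> {x, z} \<noteq> {}"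
      using int[OF e e1] int[OF e e2(1)] int[OF e e3(1)] ab xy z e3' by auto
    then show "e \<in> complete_graph {x, y, z}" using ab xy(4) z(3) \<open>z \<noteq> x\<close> by auto
  next
    fix e assume "e \<in> complete_graph {x, y, z}"
    then obtain a b where "e = {a, b}" "a \<in> {x, y, z}" "b \<in> {x, y, z}" "a \<noteq> b" by (rule nsets2_E)
    then show "e \<in> J" using e1 e2 e3 xy z e3' by (auto simp: insert_commute)
  qed
  moreover have "{x, y, z} \<subseteq> V" "card {x, y, z} = 3" using xy z \<open>z \<noteq> x\<close> by auto
  ultimately show ?thesis unfolding is_triangle_def by blast
qed

lemma card_fixed_part:
  assumes "finite E" "T \<subseteq> E" "T0 \<subseteq> T"
  shows "card {G. G \<subseteq> E \<and> G \<inter> T = T0} = 2 ^ (card E - card T)"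
proof -
  have "bij_betw (\<lambda>X. X \<union> T0) (Pow (E - T)) {G. G \<subseteq> E \<and> G \<inter> T = T0}"
    by (rule bij_betw_byWitness[where f' = "\<lambda>G. G - T"]) (use assms in auto)
  then have "card {G. G \<subseteq> E \<and> G \<inter> T = T0} = card (Pow (E - T))"
    by (simp add: bij_betw_same_card)
  also have "\<dots> = 2 ^ (card E - card T)"
    using assms by (simp add: card_Pow card_Diff_subset finite_subset)
  finally show ?thesis .
qed

lemma sym_diff_in_family:
  assumes "finite X" "G \<in> F" "\<And>e G. e \<in> X \<Longrightarrow> G \<in> F \<Longrightarrow> toggle e G \<in> F"
  shows "sym_diff G X \<in> F"
  using assms
proof (induction X rule: finite_induct)
  case empty
  then show ?case by simp
next
  case (insert e X)
  then have "toggle e (sym_diff G X) \<in> F" by simp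
  also have "toggle e (sym_diff G X) = sym_diff G (insert e X)"
    using insert.hyps by (auto simp: toggle_def)
  finally show ?case .
qed

lemma card_edges_eight:
  assumes "card V = 8"
  shows "card (complete_graph V) = 28"
proof -
  have "(8 choose 2) = (28::nat)" by code_simp
  then show ?thesis using assms by simp
qed

lemma card_fixed_triangle:
  assumes V: "card V = 8" and T: "is_triangle V T" "T0 \<subseteq> T"
  shows "card {G. G \<subseteq> complete_graph V \<and> G \<inter> T = T0} = 2 ^ 25"
proof -
  have fin: "finite (complete_graph V)" using V by (simp add: finite_imp_finite_nsets card_ge_0_finite)
  obtain W where W: "W \<subseteq> V" "card W = 3" "T = complete_graph W" using T(1) by (auto simp: is_triangle_def)
  have "(3 choose 2) = (3::nat)" by code_simp
  then have "card T = 3" using W by simp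
  moreover have "T \<subseteq> complete_graph V" using W by (simp add: nsets_mono)
  ultimately show ?thesis using card_fixed_part[OF fin _ T(2)] card_edges_eight[OF V] by simp
qed

lemma extremal_triangulumvirate:
  assumes V: "card V = 8" and F: "F \<subseteq> Pow (complete_graph V)" and nb: "non_bipartite_agreeing V F"
    and cardF: "card F = 2 ^ 25"
  shows "triangulumvirate V F"
proof -
  let ?E = "complete_graph V"
  have fin: "finite ?E" using V by (simp add: finite_imp_finite_nsets card_ge_0_finite)
  have finF: "finite F" using F fin by (simp add: finite_subset)
  obtain G0 where G0: "G0 \<in> F" using cardF by fastforce
  have van: "hat F S = 0" if "S \<subseteq> ?E" "4 \<le> card S \<or> (\<exists>a\<in>S. \<exists>b\<in>S. a \<inter> b = {})" for S
    using card_le_and_hat_zero(2)[OF V F nb cardF that] .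
  define J where "J = {e \<in> ?E. \<exists>G\<subseteq>?E. (G \<in> F) \<noteq> (toggle e G \<in> F)}"
  have J: "J \<subseteq> ?E" by (auto simp: J_def)
  have leave: "toggle e G \<notin> F" if e: "e \<in> J" and G: "G \<in> F" for e G
  proof -
    obtain G1 where "e \<in> ?E" "G1 \<subseteq> ?E" "(G1 \<in> F) \<noteq> (toggle e G1 \<in> F)"
      using e unfolding J_def by blast
    then show ?thesis
      using toggle_leaves_family[OF fin F _ _ _ _ _ G] van card_edges_eight[OF V] cardF by simp
  qed
  have stay: "toggle e G \<in> F" if "e \<in> ?E - J" "G \<in> F" for e G
    using that F by (auto simp: J_def)
  \<comment> \<open>So membership in \<open>F\<close> depends only on the intersection with
    \<open>J\<close>.\<close>
  have move: "sym_diff G X \<in> F" if "X \<subseteq> ?E - J" "G \<in> F" for G X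
    using that stay fin by (intro sym_diff_in_family) (auto intro: finite_subset)
  have "is_triangle V J"
  proof (rule intersecting_edges_triangle[OF J])
    fix e e' assume e: "e \<in> J" "e' \<in> J"
    show "e \<inter> e' \<noteq> {}"
    proof
      assume dis: "e \<inter> e' = {}"
      \<comment> \<open>The left side is at least 1 because of \<open>G0\<close>, whereas the right
        side is 0 by \<open>leave\<close>.\<close>
      have "of_bool (G0 \<in> F) + of_bool (toggle e' (toggle e G0) \<in> F)
       = (of_bool (toggle e G0 \<in> F) + of_bool (toggle e' G0 \<in> F) :: real)"
        using e J G0 F dis van by (intro mixed_difference_zero[OF fin F]) blast+
      then show False using G0 leave[OF e(1) G0] leave[OF e(2) G0] by (simp add: of_bool_def split: if_splits)
    qed
  next
    fix v
    \<comment> \<open>Changing \<open>G0\<close> in all edges outside \<open>J\<close> gives a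
      member of \<open>F\<close> whose agreement with \<open>G0\<close> is exactly \<open>J\<close>.
      Hence \<open>J\<close> is not bipartite, and in particular not a star.\<close>
    have "sym_diff G0 (?E - J) \<in> F" by (rule move[OF subset_refl G0])
    then have "\<not> bipartite V (agreement V G0 (sym_diff G0 (?E - J)))"
      using nb G0 by (auto simp: non_bipartite_agreeing_def)
    moreover have "agreement V G0 (sym_diff G0 (?E - J)) = J"
      using J G0 F by (auto simp: agreement_def graph_complement_def)
    ultimately show "\<exists>e\<in>J. v \<notin> e" using bipartite_star[OF J] by auto
  qed
  \<comment> \<open>One inclusion suffices, since both families have \<open>2 ^ 25\<close>
    members.\<close>
  moreover have "F = {G. G \<subseteq> ?E \<and> G \<inter> J = G0 \<inter> J}"
  proof (rule sym, rule card_subset_eq[OF finF])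
    show "{G. G \<subseteq> ?E \<and> G \<inter> J = G0 \<inter> J} \<subseteq> F"
    proof
      fix G assume G: "G \<in> {G. G \<subseteq> ?E \<and> G \<inter> J = G0 \<inter> J}"
      then have "sym_diff G0 (sym_diff G0 G) \<in> F" using G0 F by (intro move) auto
      also have "sym_diff G0 (sym_diff G0 G) = G" by auto
      finally show "G \<in> F" .
    qed
    show "card {G. G \<subseteq> ?E \<and> G \<inter> J = G0 \<inter> J} = card F"
      using card_fixed_triangle[OF V calculation] cardF by simp
  qed
  ultimately show ?thesis unfolding triangulumvirate_def by (intro exI[of _ J] exI[of _ "G0 \<inter> J"]) auto
qed

theorem theorem1:
  fixes V :: "'a set" and F :: "'a set set set"
  assumes "card V = 8"
    and "\<And>G. G \<in> F \<Longrightarrow> G \<subseteq> complete_graph V"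
    and "non_bipartite_agreeing V F"
  shows "card F \<le> 2 ^ ((8 choose 2) - 3)
    \<and> (2::nat) ^ ((8 choose 2) - 3) = 2 ^ 25
    \<and> (card F = 2 ^ ((8 choose 2) - 3) \<longleftrightarrow> triangulumvirate V F)"
proof -
  have "(8 choose 2) = (28::nat)" by code_simp
  then have exponent: "(2::nat) ^ ((8 choose 2) - 3) = 2 ^ 25" by simp
  have F: "F \<subseteq> Pow (complete_graph V)" using assms(2) by auto
  have "card F = 2 ^ 25" if "triangulumvirate V F"
    using that card_fixed_triangle[OF assms(1)] by (auto simp: triangulumvirate_def)
  then show ?thesis
    unfolding exponent
    using card_le_and_hat_zero(1)[OF assms(1) F assms(3)] extremal_triangulumvirate[OF assms(1) F assms(3)]
    by blast
qed

end
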